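(* Let $G_0\in\mathcal{L}_n$ be a signed graph with $d$ edges, and let $G_1,G_2,G_3$ be obtained from $G_0$ by any one of the six reductions (R1)–(R6). Then $G_1,G_2,G_3\in\mathcal{L}_n$, $$\mathcal{P}(G_0)=\mathcal{P}(G_1)\cup\mathcal{P}(G_2),$$ where all polytopes $\mathcal{P}(G_0),\mathcal{P}(G_1),\mathcal{P}(G_2)$ are $d$-dimensional, and $$\mathcal{P}(G_3)=\mathcal{P}(G_1)\cap\mathcal{P}(G_2)\quad\text{is }(d-1)\text{-dimensional}.$$
   Context: A signed graph $G$ on $[n]=\{1,\dots,n\}$ is a finite multigraph (loops allowed) with each edge labeled $+$ or $-$; all loops are labeled $+$. An edge with endpoints $i,j$ and sign $\epsilon$ is written $(i,j,\epsilon)=(j,i,\epsilon)$. Let $e_1,\dots,e_n$ be the standard basis of $\mathbb{R}^n$. For an edge with $i\le j$ put $\mathrm{v}(i,j,-)=e_i-e_j$ (here $i<j$) and $\mathrm{v}(i,j,+)=e_i+e_j$ (so $\mathrm{v}(i,i,+)=2e_i$). Let $\Phi^+=\{e_i-e_j,\ e_i+e_j,\ 2e_k : 1\le i<j\le n,\ k\in[n]\}$. The cone $\mathcal{C}(G)$ is the set of nonnegative linear combinations of the vectors $\mathrm{v}(e)$, $e\in E(G)$. The root polytope is $\mathcal{P}(G)=\operatorname{ConvHull}(\{0\}\cup(\Phi^+\cap\mathcal{C}(G)))$. $\mathcal{L}_n$ is the set of signed graphs $G$ on $[n]$ for which the vectors $\mathrm{v}(e)$, $e\in E(G)$, are linearly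 independent. Reductions. Each one takes two edges $a,b\in E(G_0)$ of the given form, and a third edge $c$, and defines graphs on $[n]$ by $E(G_1)=E(G_0)\setminus\{b\}\cup\{c\}$, $E(G_2)=E(G_0)\setminus\{a\}\cup\{c\}$, $E(G_3)=E(G_0)\setminus\{a,b\}\cup\{c\}$: (R1) $a=(i,j,-)$, $b=(j,k,-)$, $c=(i,k,-)$, for $i<j<k$; (R2) $a=(i,j,-)$, $b=(j,k,+)$, $c=(i,k,+)$, for $i<j<k$; (R3) $a=(i,k,-)$, $b=(j,k,+)$, $c=(i,j,+)$, for $i<j<k$; (R4) $a=(i,k,+)$, $b=(j,k,-)$, $c=(i,j,+)$, for $i<j<k$; (R5) $a=(i,j,-)$, $b=(i,j,+)$, $c=(i,i,+)$, for $i<j$; (R6) $a=(i,j,-)$, $b=(j,j,+)$, $c=(i,j,+)$, for $i<j$. *)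

theory Defs
  imports "HOL-Analysis.Analysis" "HOL-Library.Uprod" "HOL-Library.Multiset"
begin

text \<open>
  The vertex set \<open>[n]\<close> is a finite linearly ordered type \<open>'n\<close>
  with \<open>n = CARD('n)\<close>, so that \<open>real ^ 'n\<close> is the ambient space.
  Edges have unordered endpoints, so that \<open>(i, j, \<epsilon>) = (j, i, \<epsilon>)\<close>
  holds definitionally, and a multigraph is the finite multiset of its edges.
\<close>

datatype sgn = Plus | Minus

type_synonym 'n sedge = "'n uprod \<times> sgn"

abbreviation sedge :: "'n \<Rightarrow> 'n \<Rightarrow> sgn \<Rightarrow> 'n sedge" where
  "sedge i j s \<equiv> (Upair i j, s)"

type_synonym 'n multigraph = "'n sedge multiset"

definition signed_graph :: "'n multigraph \<Rightarrow> bool" where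
  "signed_graph G \<longleftrightarrow> (\<forall>i. sedge i i Minus \<notin># G)"

definition edge_vec :: "'n::{finite,linorder} sedge \<Rightarrow> real ^ 'n::{finite,linorder}" where
  "edge_vec e =
    (let i = Min (set_uprod (fst e)); j = Max (set_uprod (fst e))
     in case snd e of
          Plus \<Rightarrow> axis i 1 + axis j 1
        | Minus \<Rightarrow> axis i 1 - axis j 1)"

lemma edge_vec_Plus: "edge_vec (sedge i j Plus) = axis i 1 + axis j 1"
  by (cases "i \<le> j") (auto simp: edge_vec_def min_def max_def add.commute)

lemma edge_vec_Minus: "i \<le> j \<Longrightarrow> edge_vec (sedge i j Minus) = axis i 1 - axis j 1"
  by (auto simp: edge_vec_def min_def max_def)

definition positive_roots :: "(real ^ 'n::{finite,linorder}) set" where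
  "positive_roots =
    {axis i 1 - axis j 1 | i j. i < j} \<union>
    {axis i 1 + axis j 1 | i j. i < j} \<union>
    {2 *\<^sub>R axis k 1 | k. True}"

definition graph_cone :: "'n::{finite,linorder} multigraph \<Rightarrow> (real ^ 'n::{finite,linorder}) set" where
  "graph_cone G =
    {(\<Sum>e\<in>set_mset G. c e *\<^sub>R edge_vec e) | c. \<forall>e\<in>set_mset G. 0 \<le> c e}"

definition root_polytope :: "'n::{finite,linorder} multigraph \<Rightarrow> (real ^ 'n::{finite,linorder}) set" where
  "root_polytope G = convex hull ({0} \<union> (positive_roots \<inter> graph_cone G))"

text \<open>
  The vectors \<open>edge_vec e\<close> are independent as a family indexed by the edges
  with multiplicity: no vector is repeated, and the set of vectors is independent.
\<close>

definition indep_graphs :: "'n::{finite,linorder} multigraph set" where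
  "indep_graphs =
    {G. signed_graph G \<and>
        (\<forall>x. count (image_mset edge_vec G) x \<le> 1) \<and>
        independent (set_mset (image_mset edge_vec G))}"

inductive reduction_edges ::
  "'n::{finite,linorder} sedge \<Rightarrow> 'n sedge \<Rightarrow> 'n sedge \<Rightarrow> bool" where
  R1: "i < j \<Longrightarrow> j < k \<Longrightarrow>
    reduction_edges (sedge i j Minus) (sedge j k Minus) (sedge i k Minus)"
| R2: "i < j \<Longrightarrow> j < k \<Longrightarrow>
    reduction_edges (sedge i j Minus) (sedge j k Plus) (sedge i k Plus)"
| R3: "i < j \<Longrightarrow> j < k \<Longrightarrow>
    reduction_edges (sedge i k Minus) (sedge j k Plus) (sedge i j Plus)"
| R4: "i < j \<Longrightarrow> j < k \<Longrightarrow>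
    reduction_edges (sedge i k Plus) (sedge j k Minus) (sedge i j Plus)"
| R5: "i < j \<Longrightarrow>
    reduction_edges (sedge i j Minus) (sedge i j Plus) (sedge i i Plus)"
| R6: "i < j \<Longrightarrow>
    reduction_edges (sedge i j Minus) (sedge j j Plus) (sedge i j Plus)"

definition reduction ::
  "'n::{finite,linorder} multigraph \<Rightarrow> 'n multigraph \<Rightarrow> 'n multigraph \<Rightarrow> 'n multigraph \<Rightarrow> bool"
where
  "reduction G0 G1 G2 G3 \<longleftrightarrow>
    (\<exists>a b c. reduction_edges a b c \<and> a \<in># G0 \<and> b \<in># G0 \<and>
       G1 = add_mset c (G0 - {#b#}) \<and>
       G2 = add_mset c (G0 - {#a#}) \<and>
       G3 = add_mset c (G0 - {#a, b#}))"

end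

theory Submission
  imports Defs
begin

text \<open>
  For every signed graph \<open>G\<close> the root polytope is the cone of \<open>G\<close> cut off by the
  \<open>l\<^sub>1\<close>-ball of radius 2. Every positive root has \<open>l\<^sub>1\<close>-norm 2, and two positive
  roots with opposite signs at a coordinate add up to a positive root. Hence a
  representation of a point of the cone by roots of the cone with least total weight
  involves no cancellation, so that its total weight is half the \<open>l\<^sub>1\<close>-norm of the point.
  The claims on union and intersection thereby reduce to cones, where they follow from
  \<open>v(c) = v(a) + v(b)\<close> by comparing the coefficients of \<open>v(a)\<close> and \<open>v(b)\<close>.
\<close>

section \<open>Positive roots: norm and closure under cancelling sums\<close>

lemma finite_positive_roots: "finite (positive_roots :: (real ^ 'n::{finite,linorder}) set)"
proof -
  have "positive_roots \<subseteq>
    (\<lambda>(i, j). axis i 1 - axis j 1) ` UNIV \<union> (\<lambda>(i, j). axis i 1 + axis j 1) ` UNIV \<union>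
    range (\<lambda>k. 2 *\<^sub>R axis k 1 :: real ^ _)"
    by (auto simp: positive_roots_def)
  then show ?thesis
    by (rule finite_subset) auto
qed

text \<open>Taking absolute values entrywise turns each of the three kinds of root into a sum of two
  unit vectors.\<close>

lemma l1_positive_root:
  fixes r :: "real ^ 'n::{finite,linorder}"
  assumes "r \<in> positive_roots"
  shows "(\<Sum>k\<in>UNIV. \<bar>r $ k\<bar>) = 2"
proof -
  have ax: "(\<Sum>k\<in>UNIV. axis i 1 $ k) = (1::real)" for i :: 'n
    by (simp add: axis_def)
  have "\<exists>i j. \<forall>k. \<bar>r $ k\<bar> = axis i 1 $ k + axis j 1 $ k"
  proof -
    consider i j where "i < j" "r = axis i 1 - axis j 1"
      | i j where "i < j" "r = axis i 1 + axis j 1" | i where "r = 2 *\<^sub>R axis i 1"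
      using assms by (auto simp: positive_roots_def)
    then show ?thesis
    proof cases
      case 1
      then show ?thesis by (intro exI[of _ i] exI[of _ j]) (auto simp: axis_def)
    next
      case 2
      then show ?thesis by (intro exI[of _ i] exI[of _ j]) (auto simp: axis_def)
    next
      case 3
      then show ?thesis by (intro exI[of _ i]) (auto simp: axis_def)
    qed
  qed
  then obtain i j where "\<And>k. \<bar>r $ k\<bar> = axis i 1 $ k + axis j 1 $ k"
    by blast
  then show ?thesis
    by (simp add: sum.distrib ax)
qed

lemma zero_notin_positive_roots: "0 \<notin> positive_roots"
  using l1_positive_root by force

text \<open>A negative entry occurs only in a difference root, at its larger index \<open>k\<close>.
  So \<open>w\<close> is e_i - e_k with i < k, and adding it replaces one e_k in \<open>v\<close> by
  e_i. A root e_k - e_l becomes e_i - e_l, which stays positive because i < k < l.\<close>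

lemma positive_roots_add:
  fixes v w :: "real ^ 'n::{finite,linorder}"
  assumes v: "v \<in> positive_roots" and w: "w \<in> positive_roots"
    and pos: "v $ k > 0" and neg: "w $ k < 0"
  shows "v + w \<in> positive_roots"
proof -
  obtain i where i: "i < k" and w_eq: "w = axis i 1 - axis k 1"
    using w neg by (auto simp: positive_roots_def axis_def split: if_splits)
  consider l where "k < l" "v = axis k 1 - axis l 1"
    | l where "l \<noteq> k" "v = axis k 1 + axis l 1" | "v = 2 *\<^sub>R axis k 1"
    using v pos by (fastforce simp: positive_roots_def axis_def add.commute split: if_splits)
  then show ?thesis
  proof cases
    case (1 l)
    then have "i < l" "v + w = axis i 1 - axis l 1" using i w_eq by auto
    then show ?thesis by (auto simp: positive_roots_def)
  next
    case (2 l)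
    then have *: "v + w = axis i 1 + axis l 1" using w_eq by simp
    consider "i < l" | "l < i" | "l = i" by (meson linorder_cases)
    then show ?thesis
    proof cases
      case 1
      then show ?thesis using * by (auto simp: positive_roots_def)
    next
      case 2
      then show ?thesis using * by (auto simp: positive_roots_def add.commute)
    next
      case 3
      then have "v + w = 2 *\<^sub>R axis i 1" using * by (simp add: scaleR_2)
      then show ?thesis by (auto simp: positive_roots_def)
    qed
  next
    case 3
    then have "v + w = axis i 1 + axis k 1" using w_eq by (simp add: scaleR_2)
    then show ?thesis using i by (auto simp: positive_roots_def)
  qed
qed

text \<open>Negative loops, which \<open>signed_graph\<close> excludes, are the only edges whose
  vector (it is 0) fails to be a root.\<close>

lemma edge_vec_in_positive_roots:
  fixes G :: "'n::{finite,linorder} multigraph"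
  assumes "signed_graph G" and "e \<in># G"
  shows "edge_vec e \<in> positive_roots"
proof -
  obtain i j s where e: "e = sedge i j s" "i \<le> j"
  proof -
    obtain p q s where "e = sedge p q s"
      by (metis uprod_exhaust surj_pair)
    moreover have "sedge p q s = sedge q p s"
      by (simp add: insert_commute)
    ultimately show thesis
      using that by (metis linear)
  qed
  show ?thesis
  proof (cases s)
    case Plus
    show ?thesis
    proof (cases "i = j")
      case True
      then have "edge_vec e = 2 *\<^sub>R axis i 1"
        using e Plus by (simp add: edge_vec_Plus scaleR_2)
      then show ?thesis unfolding positive_roots_def by blast
    next
      case False
      then have "edge_vec e = axis i 1 + axis j 1" "i < j"
        using e Plus by (auto simp: edge_vec_Plus)
      then show ?thesis unfolding positive_roots_def by blast
    qed
  next
    case Minus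
    then have "i < j" using assms e by (auto simp: signed_graph_def less_le)
    moreover have "edge_vec e = axis i 1 - axis j 1"
      using e Minus by (simp add: edge_vec_Minus)
    ultimately show ?thesis unfolding positive_roots_def by blast
  qed
qed

section \<open>Cones of signed graphs\<close>

lemma graph_cone_add:
  assumes "x \<in> graph_cone G" and "y \<in> graph_cone G"
  shows "x + y \<in> graph_cone G"
proof -
  obtain c d where "\<forall>e\<in>set_mset G. 0 \<le> c e" "x = (\<Sum>e\<in>set_mset G. c e *\<^sub>R edge_vec e)"
    and "\<forall>e\<in>set_mset G. 0 \<le> d e" "y = (\<Sum>e\<in>set_mset G. d e *\<^sub>R edge_vec e)"
    using assms unfolding graph_cone_def by blast
  then show ?thesis
    unfolding graph_cone_def
    by (intro CollectI exI[of _ "\<lambda>e. c e + d e"]) (auto simp: scaleR_add_left sum.distrib)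
qed

lemma graph_cone_scaleR:
  assumes "x \<in> graph_cone G" and "0 \<le> t"
  shows "t *\<^sub>R x \<in> graph_cone G"
proof -
  obtain c where "\<forall>e\<in>set_mset G. 0 \<le> c e" "x = (\<Sum>e\<in>set_mset G. c e *\<^sub>R edge_vec e)"
    using assms unfolding graph_cone_def by blast
  then show ?thesis
    using assms unfolding graph_cone_def
    by (intro CollectI exI[of _ "\<lambda>e. t * c e"]) (auto simp: scaleR_sum_right)
qed

lemma zero_in_graph_cone: "0 \<in> graph_cone G"
  unfolding graph_cone_def by (intro CollectI exI[of _ "\<lambda>_. 0"]) auto

lemma edge_vec_in_graph_cone: "e \<in># G \<Longrightarrow> edge_vec e \<in> graph_cone G"
  unfolding graph_cone_def
  by (intro CollectI exI[of _ "\<lambda>f. of_bool (f = e)"])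
    (auto simp: of_bool_def if_distrib[of "\<lambda>t. t *\<^sub>R _"] cong: if_cong)

lemma convex_graph_cone: "convex (graph_cone G)"
  by (simp add: convex_def graph_cone_add graph_cone_scaleR)

lemma graph_cone_subset_span: "graph_cone G \<subseteq> span (edge_vec ` set_mset G)"
  unfolding graph_cone_def by (auto intro!: span_sum span_scale intro: span_base)

text \<open>Peels off one edge, so that the cones of the reduced graphs can be compared coefficient
  by coefficient. Repeated edges do no harm, since a second copy of a vector does not enlarge the
  cone.\<close>

lemma graph_cone_add_mset:
  "graph_cone (add_mset e G) = {t *\<^sub>R edge_vec e + y | t y. 0 \<le> t \<and> y \<in> graph_cone G}"
    (is "_ = ?R")
proof (intro equalityI subsetI)
  fix x assume "x \<in> graph_cone (add_mset e G)"
  then obtain c where c: "\<forall>f\<in>set_mset (add_mset e G). 0 \<le> c f"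
    and x: "x = (\<Sum>f\<in>set_mset (add_mset e G). c f *\<^sub>R edge_vec f)"
    unfolding graph_cone_def by blast
  let ?y = "\<Sum>f\<in>set_mset G. c f *\<^sub>R edge_vec f"
  have y: "?y \<in> graph_cone G"
    using c unfolding graph_cone_def by auto
  show "x \<in> ?R"
  proof (cases "e \<in># G")
    case True
    \<comment> \<open>The term of \<open>e\<close> already occurs in \<open>?y\<close>, so the extra
      copy gets coefficient 0.\<close>
    then have "x = 0 *\<^sub>R edge_vec e + ?y" using x by (simp add: insert_absorb)
    then show ?thesis using y by blast
  next
    case False
    then have "x = c e *\<^sub>R edge_vec e + ?y" using x by simp
    then show ?thesis using y c by auto
  qed
next
  fix x assume "x \<in> ?R"
  then obtain t y where x: "x = t *\<^sub>R edge_vec e + y" and t: "0 \<le> t" and y: "y \<in> graph_cone G"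
    by blast
  have "y \<in> graph_cone (add_mset e G)"
  proof -
    obtain c where c: "\<forall>f\<in>set_mset G. 0 \<le> c f" "y = (\<Sum>f\<in>set_mset G. c f *\<^sub>R edge_vec f)"
      using y unfolding graph_cone_def by blast
    \<comment> \<open>The value of \<open>c\<close> outside \<open>G\<close> is arbitrary and
      possibly negative, hence the default 0 for a new edge.\<close>
    have "y = (\<Sum>f\<in>set_mset (add_mset e G). (if f \<in># G then c f else 0) *\<^sub>R edge_vec f)"
      unfolding c by (rule sum.mono_neutral_cong_left) auto
    then show ?thesis
      using c(1) unfolding graph_cone_def by (intro CollectI exI[of _ "\<lambda>f. if f \<in># G then c f else 0"]) auto
  qed
  then show "x \<in> graph_cone (add_mset e G)"
    unfolding x using t by (intro graph_cone_add graph_cone_scaleR edge_vec_in_graph_cone) auto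
qed

section \<open>The root polytope as a truncated cone\<close>

lemma root_polytope_eq_combinations:
  "root_polytope G = {y. \<exists>u. (\<forall>v\<in>positive_roots \<inter> graph_cone G. 0 \<le> u v) \<and>
     sum u (positive_roots \<inter> graph_cone G) \<le> 1 \<and>
     (\<Sum>v\<in>positive_roots \<inter> graph_cone G. u v *\<^sub>R v) = y}"
  \<comment> \<open>The weight of the vertex 0 is the slack in the bound by 1; this needs 0 not to
    be a root itself.\<close>
  using Starlike.simplex[of "positive_roots \<inter> graph_cone G"]
  by (simp add: root_polytope_def finite_positive_roots zero_notin_positive_roots)

text \<open>The one-sided assumption is enough: one positive term makes all terms nonnegative, and
  without a positive term all are nonpositive.\<close>

lemma abs_sum_eq_of_same_sign:
  fixes f :: "'a \<Rightarrow> real"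
  assumes "\<And>x y. x \<in> A \<Longrightarrow> y \<in> A \<Longrightarrow> 0 < f x \<Longrightarrow> 0 \<le> f y"
  shows "\<bar>sum f A\<bar> = (\<Sum>x\<in>A. \<bar>f x\<bar>)"
proof (cases "\<exists>x\<in>A. 0 < f x")
  case True
  then have "\<And>y. y \<in> A \<Longrightarrow> 0 \<le> f y" using assms by blast
  then show ?thesis by (simp add: sum_nonneg)
next
  case False
  then have "\<And>y. y \<in> A \<Longrightarrow> f y \<le> 0" by force
  then show ?thesis
    by (simp add: sum_nonpos sum_negf)
qed

text \<open>Minimal weight is obtained by stretching: for nonzero \<open>x\<close> in the cone let
  \<open>s\<close> be the largest factor that keeps \<open>s *\<^sub>R x\<close> in the polytope.
  Every representation of this boundary point by roots of the cone has weight at least 1, and one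
  has weight at most 1, hence minimal. Comparing norms then gives s \<ge> 1.\<close>

lemma root_polytope_eq:
  fixes G :: "'n::{finite,linorder} multigraph"
  assumes G: "signed_graph G"
  shows "root_polytope G = graph_cone G \<inter> {x. (\<Sum>k\<in>UNIV. \<bar>x $ k\<bar>) \<le> 2}"
proof (intro equalityI subsetI)
  fix x assume "x \<in> root_polytope G"
  moreover have "root_polytope G \<subseteq> graph_cone G"
    unfolding root_polytope_def
    by (rule hull_minimal) (auto simp: zero_in_graph_cone convex_graph_cone)
  moreover have "root_polytope G \<subseteq> {x. (\<Sum>k\<in>UNIV. \<bar>x $ k\<bar>) \<le> 2}"
    unfolding root_polytope_def
  proof (rule hull_minimal)
    show "convex {x :: (real, 'n) vec. (\<Sum>k\<in>UNIV. \<bar>x $ k\<bar>) \<le> 2}"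
    proof (rule convexI)
      fix x y :: "(real, 'n) vec" and s t :: real
      assume *: "x \<in> {x. (\<Sum>k\<in>UNIV. \<bar>x $ k\<bar>) \<le> 2}" "y \<in> {x. (\<Sum>k\<in>UNIV. \<bar>x $ k\<bar>) \<le> 2}"
        "0 \<le> s" "0 \<le> t" "s + t = 1"
      have "(\<Sum>k\<in>UNIV. \<bar>(s *\<^sub>R x + t *\<^sub>R y) $ k\<bar>) \<le> (\<Sum>k\<in>UNIV. s * \<bar>x $ k\<bar> + t * \<bar>y $ k\<bar>)"
      proof (rule sum_mono)
        fix k
        show "\<bar>(s *\<^sub>R x + t *\<^sub>R y) $ k\<bar> \<le> s * \<bar>x $ k\<bar> + t * \<bar>y $ k\<bar>"
          using * abs_triangle_ineq[of "s * x $ k" "t * y $ k"] by (simp add: abs_mult)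
      qed
      also have "\<dots> = s * (\<Sum>k\<in>UNIV. \<bar>x $ k\<bar>) + t * (\<Sum>k\<in>UNIV. \<bar>y $ k\<bar>)"
        by (simp add: sum.distrib sum_distrib_left)
      also have "\<dots> \<le> 2"
        using * by (intro convex_bound_le) auto
      finally show "s *\<^sub>R x + t *\<^sub>R y \<in> {x. (\<Sum>k\<in>UNIV. \<bar>x $ k\<bar>) \<le> 2}" by simp
    qed
  qed (auto simp: l1_positive_root)
  ultimately show "x \<in> graph_cone G \<inter> {x. (\<Sum>k\<in>UNIV. \<bar>x $ k\<bar>) \<le> 2}"
    by blast
next
  fix x assume "x \<in> graph_cone G \<inter> {x. (\<Sum>k\<in>UNIV. \<bar>x $ k\<bar>) \<le> 2}"
  then have xC: "x \<in> graph_cone G" and xl: "(\<Sum>k\<in>UNIV. \<bar>x $ k\<bar>) \<le> 2"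
    by auto
  define S where "S = positive_roots \<inter> graph_cone G"
  let ?P = "root_polytope G"
  have finS: "finite S"
    unfolding S_def using finite_positive_roots by blast
  have comb: "(\<Sum>v\<in>S. u v *\<^sub>R v) \<in> ?P" if "\<And>v. v \<in> S \<Longrightarrow> 0 \<le> u v" "sum u S \<le> 1" for u
    using that unfolding root_polytope_eq_combinations S_def by blast
  have zero: "0 \<in> ?P"
    unfolding root_polytope_def by (simp add: hull_inc)
  have compactP: "compact ?P"
    unfolding root_polytope_def using finS unfolding S_def
    by (intro finite_imp_compact_convex_hull) auto
  show "x \<in> ?P"
  proof (cases "x = 0")
    case True
    then show ?thesis using zero by simp
  next
    case False
    \<comment> \<open>The polytope is compact and \<open>x\<close> is nonzero, so the admissible
      factors form a compact set and a largest one exists.\<close>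
    define T where "T = {s. s *\<^sub>R x \<in> ?P}"
    have "compact T"
    proof -
      have "bounded T"
      proof -
        obtain B where B: "\<And>y. y \<in> ?P \<Longrightarrow> norm y \<le> B"
          using compact_imp_bounded[OF compactP] bounded_iff by metis
        show ?thesis
          unfolding bounded_iff
        proof (intro exI ballI)
          fix s assume "s \<in> T"
          then have "\<bar>s\<bar> * norm x \<le> B" using B unfolding T_def by fastforce
          then show "norm s \<le> B / norm x" using False by (simp add: field_simps)
        qed
      qed
      moreover have "closed ((\<lambda>s. s *\<^sub>R x) -` ?P)"
        by (intro closed_vimage compact_imp_closed[OF compactP] continuous_intros)
      then have "closed T" by (simp add: T_def vimage_def)
      ultimately show ?thesis by (simp add: compact_eq_bounded_closed)
    qed
    moreover have "T \<noteq> {}" using zero unfolding T_def by (auto intro: exI[of _ 0])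
    ultimately obtain s where sT: "s \<in> T" and smax: "\<And>t. t \<in> T \<Longrightarrow> t \<le> s"
      using compact_attains_sup by metis
    have "s > 0"
    proof -
      obtain c where c: "\<forall>e\<in>set_mset G. 0 \<le> c e" and x: "x = (\<Sum>e\<in>set_mset G. c e *\<^sub>R edge_vec e)"
        using xC unfolding graph_cone_def by blast
      \<comment> \<open>The summand 1 keeps \<open>m\<close> positive even if all coefficients
        vanish; after division by \<open>m\<close> it is the share left for the vertex 0.\<close>
      define m where "m = 1 + sum c (set_mset G)"
      have m: "m > 0" using c sum_nonneg[of "set_mset G" c] unfolding m_def by auto
      have "(1 / m) *\<^sub>R x = (1 / m) *\<^sub>R 0 + (\<Sum>e\<in>set_mset G. (c e / m) *\<^sub>R edge_vec e)"
        by (simp add: x scaleR_sum_right)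
      also have "\<dots> \<in> ?P"
      proof -
        text \<open>\<open>None\<close> carries the weight of the vertex \<open>0\<close>.\<close>
        have "(\<Sum>e\<in>insert None (Some ` set_mset G). (case e of None \<Rightarrow> 1 / m | Some e \<Rightarrow> c e / m) *\<^sub>R
            (case e of None \<Rightarrow> 0 | Some e \<Rightarrow> edge_vec e)) \<in> ?P"
        proof (rule convex_sum)
          show "convex ?P" unfolding root_polytope_def by simp
          have "(\<Sum>e\<in>set_mset G. c e / m) = (m - 1) / m"
            by (simp add: m_def flip: sum_divide_distrib)
          then show "(\<Sum>e\<in>insert None (Some ` set_mset G). case e of None \<Rightarrow> 1 / m | Some e \<Rightarrow> c e / m) = 1"
            using m by (simp add: sum.reindex field_simps)
          have "edge_vec e \<in> ?P" if "e \<in># G" for e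
            using that G unfolding root_polytope_def
            by (intro hull_inc) (simp add: edge_vec_in_positive_roots edge_vec_in_graph_cone)
          then show "(case e of None \<Rightarrow> 0 | Some e \<Rightarrow> edge_vec e) \<in> ?P"
            if "e \<in> insert None (Some ` set_mset G)" for e
            using that zero by auto
        qed (use c m in auto)
        then show ?thesis by (simp add: sum.reindex)
      qed
      finally have "1 / m \<in> T" unfolding T_def by simp
      with smax m show ?thesis by (meson less_le_trans zero_less_divide_1_iff)
    qed
    text \<open>Maximality of \<open>s\<close>: a combination of smaller total weight could be scaled up.\<close>
    have weight_ge: "1 \<le> sum u S"
      if u: "\<And>v. v \<in> S \<Longrightarrow> 0 \<le> u v" and sx: "s *\<^sub>R x = (\<Sum>v\<in>S. u v *\<^sub>R v)" for u
    proof (rule ccontr)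
      assume lt: "\<not> 1 \<le> sum u S"
      have "sum u S \<noteq> 0"
      proof
        assume "sum u S = 0"
        then have "\<forall>v\<in>S. u v = 0" using u finS by (simp add: sum_nonneg_eq_0_iff)
        then have "s *\<^sub>R x = 0" using sx by simp
        then show False using False \<open>s > 0\<close> by simp
      qed
      then have pos: "sum u S > 0" using u by (simp add: sum_nonneg less_le)
      have "(s / sum u S) *\<^sub>R x = (1 / sum u S) *\<^sub>R (s *\<^sub>R x)" by simp
      also have "\<dots> = (\<Sum>v\<in>S. (u v / sum u S) *\<^sub>R v)"
        unfolding sx by (simp add: scaleR_sum_right)
      also have "\<dots> \<in> ?P"
        using pos u by (intro comb) (auto simp flip: sum_divide_distrib)
      finally have "s / sum u S \<le> s" using smax unfolding T_def by simp
      with pos lt \<open>s > 0\<close> show False by (simp add: field_simps)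
    qed
    obtain u where u: "\<And>v. v \<in> S \<Longrightarrow> 0 \<le> u v" and u1: "sum u S \<le> 1"
      and sx: "s *\<^sub>R x = (\<Sum>v\<in>S. u v *\<^sub>R v)"
      using sT unfolding T_def root_polytope_eq_combinations S_def[symmetric] by force
    have no_cancel: "0 \<le> u w * w $ k" if vw: "v \<in> S" "w \<in> S" and vpos: "0 < u v * v $ k" for v w k
    proof (rule ccontr)
      assume "\<not> 0 \<le> u w * w $ k"
      then have neg: "u w * w $ k < 0" by simp
      have v: "0 < u v" "0 < v $ k"
        using vpos u[OF vw(1)] by (auto simp: zero_less_mult_iff)
      have w: "0 < u w" "w $ k < 0"
        using neg u[OF vw(2)] by (auto simp: mult_less_0_iff)
      have "v \<noteq> w" using v w by auto
      have "v + w \<in> S"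
        using vw positive_roots_add[OF _ _ v(2) w(2)] unfolding S_def by (auto intro: graph_cone_add)
      \<comment> \<open>Moving weight \<open>t\<close> from both \<open>v\<close> and
        \<open>w\<close> to the root \<open>v + w\<close> preserves the point and lowers the total
        weight by \<open>t\<close>, contradicting \<open>weight_ge\<close>. The minimum is the most
        that can be moved while keeping weights nonnegative.\<close>
      define t where "t = min (u v) (u w)"
      define u' where "u' p = u p - (if p = v then t else 0) - (if p = w then t else 0)
        + (if p = v + w then t else 0)" for p
      have "sum u' S = sum u S - t"
        unfolding u'_def using vw finS \<open>v + w \<in> S\<close>
        by (simp add: sum.distrib sum_subtractf)
      moreover have "(\<Sum>p\<in>S. u' p *\<^sub>R p) = (\<Sum>p\<in>S. u p *\<^sub>R p) - t *\<^sub>R v - t *\<^sub>R w + t *\<^sub>R (v + w)"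
        unfolding u'_def using vw finS \<open>v + w \<in> S\<close>
        by (simp add: sum.distrib sum_subtractf scaleR_add_left scaleR_diff_left
            if_distrib[of "\<lambda>t. t *\<^sub>R _"] del: scaleR_add_right cong: if_cong)
      then have "s *\<^sub>R x = (\<Sum>p\<in>S. u' p *\<^sub>R p)"
        unfolding sx by (simp add: scaleR_add_right)
      moreover have "0 \<le> u' p" if "p \<in> S" for p
        using u[OF that] v w \<open>v \<noteq> w\<close> unfolding u'_def t_def by auto
      moreover have "t > 0" using v w unfolding t_def by simp
      ultimately show False using weight_ge[of u'] u1 by simp
    qed
    have "s * (\<Sum>k\<in>UNIV. \<bar>x $ k\<bar>) = (\<Sum>k\<in>UNIV. \<bar>(s *\<^sub>R x) $ k\<bar>)"
      using \<open>s > 0\<close> by (simp add: sum_distrib_left abs_mult)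
    also have "\<dots> = (\<Sum>k\<in>UNIV. \<bar>\<Sum>v\<in>S. u v * v $ k\<bar>)"
      unfolding sx by simp
    \<comment> \<open>In each coordinate all terms have the same sign, so the absolute value passes
      inside the sum.\<close>
    also have "\<dots> = (\<Sum>k\<in>UNIV. \<Sum>v\<in>S. \<bar>u v * v $ k\<bar>)"
      using no_cancel by (intro sum.cong refl abs_sum_eq_of_same_sign)
    also have "\<dots> = (\<Sum>v\<in>S. \<Sum>k\<in>UNIV. \<bar>u v * v $ k\<bar>)"
      by (rule sum.swap)
    also have "\<dots> = (\<Sum>v\<in>S. u v * 2)"
    proof (rule sum.cong[OF refl])
      fix v assume "v \<in> S"
      then have "(\<Sum>k\<in>UNIV. \<bar>v $ k\<bar>) = 2" "0 \<le> u v"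
        using l1_positive_root u unfolding S_def by auto
      then show "(\<Sum>k\<in>UNIV. \<bar>u v * v $ k\<bar>) = u v * 2"
        by (simp add: abs_mult flip: sum_distrib_left)
    qed
    also have "\<dots> = 2 * sum u S"
      by (simp flip: sum_distrib_right)
    also have "\<dots> \<ge> 2" using weight_ge[OF u sx] by simp
    finally have "2 \<le> s * (\<Sum>k\<in>UNIV. \<bar>x $ k\<bar>)" .
    also have "\<dots> \<le> s * 2"
      using xl \<open>s > 0\<close> by (intro mult_left_mono) auto
    finally have "s \<ge> 1" by simp
    \<comment> \<open>As s \<ge> 1, the point \<open>x\<close> lies on the segment from 0 to
      \<open>s *\<^sub>R x\<close>.\<close>
    have "(1 - 1 / s) *\<^sub>R 0 + (1 / s) *\<^sub>R (s *\<^sub>R x) \<in> ?P"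
      using sT zero \<open>s \<ge> 1\<close> unfolding T_def root_polytope_def
      by (intro convexD[OF convex_convex_hull]) auto
    then show ?thesis using \<open>s > 0\<close> by simp
  qed
qed

section \<open>Dimension and independence\<close>

lemma aff_dim_root_polytope:
  fixes G :: "'n::{finite,linorder} multigraph"
  assumes "G \<in> indep_graphs"
  shows "aff_dim (root_polytope G) = int (size G)"
proof -
  let ?V = "edge_vec ` set_mset G"
  have G: "signed_graph G" and cnt: "\<And>x. count (image_mset edge_vec G) x \<le> 1"
    and ind: "independent ?V"
    using assms by (auto simp: indep_graphs_def)
  have "0 \<in> root_polytope G"
    unfolding root_polytope_def by (simp add: hull_inc)
  then have "aff_dim (root_polytope G) = int (dim (root_polytope G))"
    by (simp add: aff_dim_zero hull_inc)
  \<comment> \<open>The polytope contains the edge vectors and lies in their span.\<close>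
  also have "dim (root_polytope G) = dim ?V"
  proof (rule antisym)
    show "dim (root_polytope G) \<le> dim ?V"
      using graph_cone_subset_span[of G] unfolding root_polytope_eq[OF G]
      by (metis dim_span dim_subset inf.coboundedI1)
    show "dim ?V \<le> dim (root_polytope G)"
    proof (intro dim_subset subsetI)
      fix v assume "v \<in> ?V"
      then show "v \<in> root_polytope G"
        using G unfolding root_polytope_def
        by (intro hull_inc) (auto simp: edge_vec_in_positive_roots edge_vec_in_graph_cone)
    qed
  qed
  also have "dim ?V = card ?V"
    using ind by (simp add: dim_eq_card_independent)
  \<comment> \<open>Edges are counted with multiplicity, but no vector repeats, so every count is
    exactly 1.\<close>
  also have "card ?V = size (image_mset edge_vec G)"
  proof -
    have "size (image_mset edge_vec G) = (\<Sum>x\<in>?V. count (image_mset edge_vec G) x)"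
      by (simp only: size_multiset_overloaded_eq set_image_mset)
    also have "\<dots> = (\<Sum>x\<in>?V. 1)"
    proof (rule sum.cong[OF refl])
      fix x assume "x \<in> ?V"
      then have "x \<in># image_mset edge_vec G" by simp
      then show "count (image_mset edge_vec G) x = 1"
        using cnt[of x] by (simp only: count_greater_zero_iff[symmetric])
    qed
    finally show ?thesis by simp
  qed
  finally show ?thesis by simp
qed

text \<open>The single span condition covers both ways a new edge can fail: repeating a vector
  already present, or depending on several of them.\<close>

lemma add_mset_in_indep_graphs_iff:
  "add_mset e G \<in> indep_graphs \<longleftrightarrow>
    (\<forall>i. e \<noteq> sedge i i Minus) \<and> G \<in> indep_graphs \<and> edge_vec e \<notin> span (edge_vec ` set_mset G)"
proof -
  let ?V = "edge_vec ` set_mset G" and ?v = "edge_vec e"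
  have "(\<forall>x. count (image_mset edge_vec (add_mset e G)) x \<le> 1) \<longleftrightarrow>
    (\<forall>x. count (image_mset edge_vec G) x \<le> 1) \<and> ?v \<notin> ?V"
  proof -
    have "?v \<notin> ?V \<longleftrightarrow> count (image_mset edge_vec G) ?v = 0"
      by (metis count_eq_zero_iff set_image_mset)
    moreover have "(\<forall>x. (if ?v = x then Suc (f x) else f x) \<le> 1) \<longleftrightarrow> (\<forall>x. f x \<le> 1) \<and> f ?v = 0"
      for f :: "_ \<Rightarrow> nat"
    proof (intro iffI conjI allI)
      assume *: "\<forall>x. (if ?v = x then Suc (f x) else f x) \<le> 1"
      show "f x \<le> 1" for x using *[rule_format, of x] by (simp split: if_splits)
      show "f ?v = 0" using *[rule_format, of ?v] by simp
    qed auto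
    ultimately show ?thesis
      by (simp only: image_mset_add_mset count_add_mset)
  qed
  moreover have "independent (insert ?v ?V) \<and> ?v \<notin> ?V \<longleftrightarrow> independent ?V \<and> ?v \<notin> span ?V"
    using independent_insert[of ?v ?V] span_base[of ?v ?V] by auto
  ultimately show ?thesis
    by (auto simp: indep_graphs_def signed_graph_def)
qed

section \<open>The six reductions\<close>

lemma reduction_edges_cases:
  fixes a b c :: "'n::{finite,linorder} sedge"
  assumes "reduction_edges a b c"
  shows "edge_vec c = edge_vec a + edge_vec b" and "a \<noteq> b" and "c \<noteq> sedge i i Minus"
proof -
  show "edge_vec c = edge_vec a + edge_vec b"
    using assms by cases (simp_all add: edge_vec_Plus edge_vec_Minus)
  show "a \<noteq> b"
    using assms by cases auto
  show "c \<noteq> sedge i i Minus"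
    using assms by cases auto
qed

theorem lemma3:
  fixes G0 G1 G2 G3 :: "'n::{finite,linorder} multigraph" and d :: nat
  assumes "G0 \<in> indep_graphs"
    and "size G0 = d"
    and "reduction G0 G1 G2 G3"
  shows "G1 \<in> indep_graphs \<and> G2 \<in> indep_graphs \<and> G3 \<in> indep_graphs
    \<and> root_polytope G0 = root_polytope G1 \<union> root_polytope G2
    \<and> aff_dim (root_polytope G0) = int d
    \<and> aff_dim (root_polytope G1) = int d
    \<and> aff_dim (root_polytope G2) = int d
    \<and> root_polytope G3 = root_polytope G1 \<inter> root_polytope G2
    \<and> aff_dim (root_polytope G3) = int d - 1"
proof -
  obtain a b c where red: "reduction_edges a b c" and ab: "a \<in># G0" "b \<in># G0"
    and G: "G1 = add_mset c (G0 - {#b#})" "G2 = add_mset c (G0 - {#a#})"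
      "G3 = add_mset c (G0 - {#a, b#})"
    using assms(3) unfolding reduction_def by blast
  \<comment> \<open>From here on the six rules are treated alike: only
    \<open>v(c) = v(a) + v(b)\<close>, the distinctness of \<open>a\<close> and \<open>b\<close>,
    and the fact that \<open>c\<close> is no negative loop enter.\<close>
  note c_eq = reduction_edges_cases(1)[OF red] and c_loop = reduction_edges_cases(3)[OF red]
  define H where "H = G0 - {#a, b#}"
  have G0: "G0 = add_mset a (add_mset b H)"
  proof -
    \<comment> \<open>Since \<open>a\<close> and \<open>b\<close> differ, removing \<open>a\<close>
      leaves \<open>b\<close> in place.\<close>
    have "b \<in># G0 - {#a#}"
      using ab reduction_edges_cases(2)[OF red] by (simp add: in_diff_count)
    then obtain K where "G0 - {#a#} = add_mset b K"
      by (blast dest: multi_member_split)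
    then have "G0 = add_mset a (add_mset b K)"
      using insert_DiffM[OF ab(1)] by simp
    then show ?thesis
      unfolding H_def by simp
  qed
  have G1: "G1 = add_mset c (add_mset a H)" and G2: "G2 = add_mset c (add_mset b H)"
    and G3: "G3 = add_mset c H"
    using G(1,2) G(3)[folded H_def] unfolding G0 by (simp_all add: add_mset_commute[of a b])
  let ?a = "edge_vec a" and ?b = "edge_vec b" and ?c = "edge_vec c"
    and ?U = "span (edge_vec ` set_mset H)"
  have ind_a: "add_mset a H \<in> indep_graphs" and ind_b: "add_mset b H \<in> indep_graphs"
    and a_notin: "?a \<notin> span (insert ?b (edge_vec ` set_mset H))"
    and b_notin: "?b \<notin> span (insert ?a (edge_vec ` set_mset H))"
    using assms(1) assms(1)[unfolded G0 add_mset_commute[of a b H]]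
    unfolding G0 add_mset_in_indep_graphs_iff[of a "add_mset b H"]
      add_mset_in_indep_graphs_iff[of b "add_mset a H"]
    by simp_all
  \<comment> \<open>Modulo a span containing \<open>?a\<close>, the vector \<open>?c\<close> agrees
    with \<open>?b\<close>, and symmetrically.\<close>
  have c_notin: "?c \<notin> span (insert ?a (edge_vec ` set_mset H))"
    "?c \<notin> span (insert ?b (edge_vec ` set_mset H))"
    using a_notin b_notin unfolding c_eq
    by (simp_all add: span_add_eq span_add_eq2 span_base)
  have ind1: "G1 \<in> indep_graphs" and ind2: "G2 \<in> indep_graphs"
    using ind_a ind_b c_notin c_loop
    unfolding G1 G2 by (simp_all add: add_mset_in_indep_graphs_iff[of c])
  have ind3: "G3 \<in> indep_graphs"
    using ind1 unfolding G1 G3 add_mset_commute[of c a]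
    by (simp add: add_mset_in_indep_graphs_iff[of a])
  \<comment> \<open>The vectors of \<open>a\<close> and \<open>b\<close> are independent modulo
    \<open>?U\<close>: adjoining one of them to the spanning set absorbs its term and isolates the
    other.\<close>
  have coeffs: "p = 0 \<and> q = 0" if pq: "p *\<^sub>R ?a + q *\<^sub>R ?b \<in> ?U" for p q
  proof -
    have "p *\<^sub>R ?a + q *\<^sub>R ?b \<in> span (insert ?a (edge_vec ` set_mset H))"
      "p *\<^sub>R ?a + q *\<^sub>R ?b \<in> span (insert ?b (edge_vec ` set_mset H))"
      using pq span_mono[OF subset_insertI] by blast+
    then have "q *\<^sub>R ?b \<in> span (insert ?a (edge_vec ` set_mset H))"
      and "p *\<^sub>R ?a \<in> span (insert ?b (edge_vec ` set_mset H))"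
      by (simp_all add: span_add_eq span_add_eq2 span_scale span_base)
    moreover have "t = 0" if "t *\<^sub>R v \<in> span A" "v \<notin> span A" for t and v :: "(real, 'n) vec" and A
      using span_scale[OF that(1), of "1 / t"] that(2) by (cases "t = 0") simp_all
    ultimately show ?thesis
      using a_notin b_notin by blast
  qed
  have cone0: "graph_cone G0 = graph_cone G1 \<union> graph_cone G2"
  proof (intro equalityI subsetI)
    fix x assume "x \<in> graph_cone G0"
    then obtain s t y where x: "x = s *\<^sub>R ?a + (t *\<^sub>R ?b + y)" "0 \<le> s" "0 \<le> t" "y \<in> graph_cone H"
      unfolding G0 graph_cone_add_mset by blast
    show "x \<in> graph_cone G1 \<union> graph_cone G2"
    \<comment> \<open>The smaller of the two coefficients is transferred to \<open>c\<close>, which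
      leaves only \<open>a\<close> or only \<open>b\<close>.\<close>
    proof (cases "t \<le> s")
      case True
      have "x = t *\<^sub>R ?c + ((s - t) *\<^sub>R ?a + y)"
        unfolding x c_eq by (simp add: algebra_simps)
      moreover have "0 \<le> s - t" using True by simp
      ultimately have "x \<in> graph_cone G1"
        using x(3,4) unfolding G1 graph_cone_add_mset by blast
      then show ?thesis ..
    next
      case False
      have "x = s *\<^sub>R ?c + ((t - s) *\<^sub>R ?b + y)"
        unfolding x c_eq by (simp add: algebra_simps)
      moreover have "0 \<le> t - s" using False by simp
      ultimately have "x \<in> graph_cone G2"
        using x(2,4) unfolding G2 graph_cone_add_mset by blast
      then show ?thesis ..
    qed
  next
    fix x assume "x \<in> graph_cone G1 \<union> graph_cone G2"
    \<comment> \<open>A zero coefficient for the missing edge lets both cones share one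
      form.\<close>
    then obtain r s t y where x: "x = r *\<^sub>R ?c + (s *\<^sub>R ?a + (t *\<^sub>R ?b + y))"
      "0 \<le> r" "0 \<le> s" "0 \<le> t" "y \<in> graph_cone H"
    proof
      assume "x \<in> graph_cone G1"
      then obtain r s y where "x = r *\<^sub>R ?c + (s *\<^sub>R ?a + y)" "0 \<le> r" "0 \<le> s" "y \<in> graph_cone H"
        unfolding G1 graph_cone_add_mset by blast
      then show thesis using that[of r s 0 y] by simp
    next
      assume "x \<in> graph_cone G2"
      then obtain r t y where "x = r *\<^sub>R ?c + (t *\<^sub>R ?b + y)" "0 \<le> r" "0 \<le> t" "y \<in> graph_cone H"
        unfolding G2 graph_cone_add_mset by blast
      then show thesis using that[of r 0 t y] by simp
    qed
    have "x = (r + s) *\<^sub>R ?a + ((r + t) *\<^sub>R ?b + y)"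
      unfolding x c_eq by (simp add: algebra_simps)
    moreover have "0 \<le> r + s" "0 \<le> r + t" using x by auto
    ultimately show "x \<in> graph_cone G0"
      unfolding G0 graph_cone_add_mset using x(5) by blast
  qed
  have cone3: "graph_cone G3 = graph_cone G1 \<inter> graph_cone G2"
  proof (intro equalityI subsetI)
    fix x assume "x \<in> graph_cone G3"
    then obtain r y where "x = r *\<^sub>R ?c + y" "0 \<le> r" "y \<in> graph_cone H"
      unfolding G3 graph_cone_add_mset by blast
    \<comment> \<open>The vanishing term with arbitrary \<open>v\<close> serves as the term of
      \<open>a\<close> for \<open>G1\<close> and of \<open>b\<close> for \<open>G2\<close>.\<close>
    then have x: "x = r *\<^sub>R ?c + (0 *\<^sub>R v + y)" "0 \<le> r" "y \<in> graph_cone H" for v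
      by auto
    show "x \<in> graph_cone G1 \<inter> graph_cone G2"
      unfolding G1 G2 graph_cone_add_mset using x by blast
  next
    fix x assume "x \<in> graph_cone G1 \<inter> graph_cone G2"
    then obtain r s y r' t z where x: "x = r *\<^sub>R ?c + (s *\<^sub>R ?a + y)" "0 \<le> r" "0 \<le> s" "y \<in> graph_cone H"
      and x': "x = r' *\<^sub>R ?c + (t *\<^sub>R ?b + z)" "0 \<le> r'" "0 \<le> t" "z \<in> graph_cone H"
      unfolding G1 G2 graph_cone_add_mset by blast
    \<comment> \<open>Subtracting the two representations leaves a combination of \<open>?a\<close>
      and \<open>?b\<close> in \<open>?U\<close>, so both coefficients vanish. Their difference is s
      + t, a sum of nonnegative numbers, hence s = 0.\<close>
    have "(r + s - r') *\<^sub>R ?a + (r - r' - t) *\<^sub>R ?b = z - y"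
      using x(1) x'(1) unfolding c_eq by (simp add: algebra_simps)
    moreover have "z - y \<in> ?U"
      using x(4) x'(4) graph_cone_subset_span by (metis span_diff subsetD)
    ultimately have "r + s - r' = 0 \<and> r - r' - t = 0"
      using coeffs by metis
    then have "s = 0" using x(3) x'(3) by linarith
    then show "x \<in> graph_cone G3"
      using x unfolding G3 graph_cone_add_mset by auto
  qed
  have signed: "signed_graph G0" "signed_graph G1" "signed_graph G2" "signed_graph G3"
    using assms(1) ind1 ind2 ind3 by (auto simp: indep_graphs_def)
  \<comment> \<open>All four polytopes are cut from their cones by the same ball, so the cone
    identities carry over.\<close>
  have union: "root_polytope G0 = root_polytope G1 \<union> root_polytope G2"
    and inter: "root_polytope G3 = root_polytope G1 \<inter> root_polytope G2"
    using signed cone0 cone3 by (auto simp: root_polytope_eq)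
  have sizes: "size G1 = d" "size G2 = d" "int (size G3) = int d - 1"
    using assms(2) unfolding G0 G1 G2 G3 by auto
  show ?thesis
    using ind1 ind2 ind3 assms(1,2) union inter sizes aff_dim_root_polytope by metis
qed

end
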